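(* Let $\varepsilon,p$ be two real numbers such that $0<\varepsilon<2d$ and $p\ge1$. Then there is a nonnegative constant $M_{\varepsilon,p}$ such that for every quaternion window function $g$, every $f\in L^2(\mathbb{R}^{2d},\mathbb{H})$ and every measurable subset $\Sigma$ of $\mathbb{R}^{2d}\times\mathbb{R}^{2d}$ of finite measure, $$\|\chi_\Sigma\mathcal{G}_g(f)\|_{p,4d}^{p(p+1)}\le M_{\varepsilon,p}\;\mu_{4d}(\Sigma)\;\big\||(x,w)|^\varepsilon\mathcal{G}_g(f)\big\|_{2,4d}^{\frac{4pd}{2d+\varepsilon}}\big(\|f\|_{2,2d}\|g\|_{2,2d}\big)^{p\left(p-\frac{2d-\varepsilon}{2d+\varepsilon}\right)},$$ where $$M_{\varepsilon,p}=\left(\frac{2d+\varepsilon}{2^{\frac{\varepsilon(2d+2p+2)}{(2d+\varepsilon)(p+1)}}\,\varepsilon^{\frac{2\varepsilon}{2d+\varepsilon}}\,\Gamma(2d)^{\frac{\varepsilon}{(2d+\varepsilon)(p+1)}}\,(2d-\varepsilon)^{\frac{2d-\varepsilon}{2d+\varepsilon}+\frac{\varepsilon}{(2d+\varepsilon)(p+1)}}}\right)^{p(p+1)}.$$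
   Context: $d\ge 1$ is an integer and $\mathbb{H}$ is the algebra of quaternions with units $i,j,k$. On $\mathbb{R}^n$, $d\mu_n(x)=dx/(2\pi)^{n/2}$, $\|F\|_{p,n}=\big(\int_{\mathbb{R}^n}|F|^pd\mu_n\big)^{1/p}\in[0,\infty]$, and $\mathbb{R}^{2d}\times\mathbb{R}^{2d}$ is identified with $\mathbb{R}^{4d}$; $|(x,w)|$ is the Euclidean norm on $\mathbb{R}^{4d}$ and $\chi_\Sigma$ the indicator function of $\Sigma$. A quaternion window function is a non-zero $g\in L^2(\mathbb{R}^{2d},\mathbb{H})$. The two sided quaternion windowed Fourier transform is $$\mathcal{G}_g(f)(x,w)=\int_{\mathbb{R}^{2d}}e^{-i\,s\cdot u}f(y)\overline{g(y-x)}e^{-j\,t\cdot v}\,d\mu_{2d}(y),\quad x\in\mathbb{R}^{2d},\ w=(u,v),\ y=(s,t)\in\mathbb{R}^d\times\mathbb{R}^d.$$ Convention: $0\cdot\infty=0$. *)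

theory Defs
  imports "HOL-Analysis.Analysis"
begin

section \<open>Quaternions\<close>

codatatype quat = Quat (qre: real) (qim1: real) (qim2: real) (qim3: real)

lemma quat_eqI:
  "qre x = qre y \<Longrightarrow> qim1 x = qim1 y \<Longrightarrow> qim2 x = qim2 y \<Longrightarrow> qim3 x = qim3 y \<Longrightarrow> x = y"
  by (rule quat.expand) simp

lemma quat_eq_iff:
  "x = y \<longleftrightarrow> qre x = qre y \<and> qim1 x = qim1 y \<and> qim2 x = qim2 y \<and> qim3 x = qim3 y"
  by (auto intro: quat_eqI)

primcorec quat_i :: quat
  where "qre quat_i = 0" | "qim1 quat_i = 1" | "qim2 quat_i = 0" | "qim3 quat_i = 0"

primcorec quat_j :: quat
  where "qre quat_j = 0" | "qim1 quat_j = 0" | "qim2 quat_j = 1" | "qim3 quat_j = 0"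

primcorec quat_k :: quat
  where "qre quat_k = 0" | "qim1 quat_k = 0" | "qim2 quat_k = 0" | "qim3 quat_k = 1"

primcorec qcnj :: "quat \<Rightarrow> quat"
  where
    "qre (qcnj x) = qre x"
  | "qim1 (qcnj x) = - qim1 x"
  | "qim2 (qcnj x) = - qim2 x"
  | "qim3 (qcnj x) = - qim3 x"

instantiation quat :: ab_group_add
begin

primcorec zero_quat
  where "qre 0 = 0" | "qim1 0 = 0" | "qim2 0 = 0" | "qim3 0 = 0"

primcorec plus_quat
  where
    "qre (x + y) = qre x + qre y"
  | "qim1 (x + y) = qim1 x + qim1 y"
  | "qim2 (x + y) = qim2 x + qim2 y"
  | "qim3 (x + y) = qim3 x + qim3 y"

primcorec uminus_quat
  where
    "qre (- x) = - qre x"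
  | "qim1 (- x) = - qim1 x"
  | "qim2 (- x) = - qim2 x"
  | "qim3 (- x) = - qim3 x"

primcorec minus_quat
  where
    "qre (x - y) = qre x - qre y"
  | "qim1 (x - y) = qim1 x - qim1 y"
  | "qim2 (x - y) = qim2 x - qim2 y"
  | "qim3 (x - y) = qim3 x - qim3 y"

instance
  by standard (simp_all add: quat_eq_iff)

end

instantiation quat :: real_algebra_1
begin

primcorec one_quat
  where "qre 1 = 1" | "qim1 1 = 0" | "qim2 1 = 0" | "qim3 1 = 0"

primcorec times_quat
  where
    "qre (x * y) = qre x * qre y - qim1 x * qim1 y - qim2 x * qim2 y - qim3 x * qim3 y"
  | "qim1 (x * y) = qre x * qim1 y + qim1 x * qre y + qim2 x * qim3 y - qim3 x * qim2 y"
  | "qim2 (x * y) = qre x * qim2 y - qim1 x * qim3 y + qim2 x * qre y + qim3 x * qim1 y"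
  | "qim3 (x * y) = qre x * qim3 y + qim1 x * qim2 y - qim2 x * qim1 y + qim3 x * qre y"

primcorec scaleR_quat
  where
    "qre (scaleR r x) = r * qre x"
  | "qim1 (scaleR r x) = r * qim1 x"
  | "qim2 (scaleR r x) = r * qim2 x"
  | "qim3 (scaleR r x) = r * qim3 x"

instance
  by standard (simp_all add: quat_eq_iff algebra_simps)

end

lemma quat_units:
  "quat_i * quat_i = - 1" "quat_j * quat_j = - 1" "quat_k * quat_k = - 1"
  "quat_i * quat_j = quat_k" "quat_j * quat_k = quat_i" "quat_k * quat_i = quat_j"
  "quat_j * quat_i = - quat_k" "quat_k * quat_j = - quat_i" "quat_i * quat_k = - quat_j"
  by (simp_all add: quat_eq_iff)

instantiation quat :: real_inner
begin

definition inner_quat_def: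
  "inner x y = qre x * qre y + qim1 x * qim1 y + qim2 x * qim2 y + qim3 x * qim3 y"

definition norm_quat_def:
  "norm x = sqrt ((qre x)\<^sup>2 + (qim1 x)\<^sup>2 + (qim2 x)\<^sup>2 + (qim3 x)\<^sup>2)"

definition sgn_quat_def: "sgn (x :: quat) = x /\<^sub>R norm x"

definition dist_quat_def: "dist (x :: quat) y = norm (x - y)"

definition uniformity_quat_def:
  "(uniformity :: (quat \<times> quat) filter) = (INF e\<in>{0 <..}. principal {(x, y). dist x y < e})"

definition open_quat_def:
  "open (U :: quat set) \<longleftrightarrow> (\<forall>x\<in>U. eventually (\<lambda>(x', y). x' = x \<longrightarrow> y \<in> U) uniformity)"

instance
proof
  fix r :: real and x y z :: quat and U :: "quat set"
  show "dist x y = norm (x - y)" by (rule dist_quat_def)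
  show "sgn x = x /\<^sub>R norm x" by (rule sgn_quat_def)
  show "(uniformity :: (quat \<times> quat) filter) = (INF e\<in>{0 <..}. principal {(x, y). dist x y < e})"
    by (rule uniformity_quat_def)
  show "open U \<longleftrightarrow> (\<forall>x\<in>U. eventually (\<lambda>(x', y). x' = x \<longrightarrow> y \<in> U) uniformity)"
    by (rule open_quat_def)
  show "inner x y = inner y x" by (simp add: inner_quat_def mult.commute)
  show "inner (x + y) z = inner x z + inner y z" by (simp add: inner_quat_def algebra_simps)
  show "inner (r *\<^sub>R x) y = r * inner x y" by (simp add: inner_quat_def algebra_simps)
  show "0 \<le> inner x x" by (simp add: inner_quat_def)
  have "a * a + b * b + c * c + d * d = 0 \<longleftrightarrow> a = 0 \<and> b = 0 \<and> c = 0 \<and> d = 0"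
    for a b c d :: real
    by (auto simp: add_nonneg_eq_0_iff)
  then show "inner x x = 0 \<longleftrightarrow> x = 0" by (simp add: inner_quat_def quat_eq_iff)
  show "norm x = sqrt (inner x x)"
    by (simp add: norm_quat_def inner_quat_def power2_eq_square)
qed

end

instantiation quat :: euclidean_space
begin

definition Basis_quat_def: "Basis = {1, quat_i, quat_j, quat_k}"

instance
proof
  have ne: "(1 :: quat) \<noteq> quat_i" "(1 :: quat) \<noteq> quat_j" "(1 :: quat) \<noteq> quat_k"
    "quat_i \<noteq> quat_j" "quat_i \<noteq> quat_k" "quat_j \<noteq> quat_k"
    by (simp_all add: quat_eq_iff)
  fix u v x :: quat
  show "(Basis :: quat set) \<noteq> {}" "finite (Basis :: quat set)"
    by (simp_all add: Basis_quat_def)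
  show "inner u v = (if u = v then 1 else 0)" if "u \<in> Basis" "v \<in> Basis"
    using that ne ne [symmetric] unfolding Basis_quat_def
    by (elim insertE emptyE; simp add: inner_quat_def)
  show "(\<forall>u\<in>Basis. inner x u = 0) \<longleftrightarrow> x = 0"
    by (simp add: Basis_quat_def inner_quat_def quat_eq_iff [of x 0])
qed

end

instantiation quat :: real_normed_div_algebra
begin

definition inverse_quat_def: "inverse (x :: quat) = qcnj x /\<^sub>R (norm x)\<^sup>2"

definition divide_quat_def: "x div (y :: quat) = x * inverse y"

instance
proof
  fix x y :: quat
  have nsq: "(norm x)\<^sup>2 = (qre x)\<^sup>2 + (qim1 x)\<^sup>2 + (qim2 x)\<^sup>2 + (qim3 x)\<^sup>2" for x :: quat
    by (simp add: norm_quat_def)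
  have cnj: "qcnj x * x = (norm x)\<^sup>2 *\<^sub>R 1" "x * qcnj x = (norm x)\<^sup>2 *\<^sub>R 1"
    by (simp_all add: quat_eq_iff nsq) (simp_all add: power2_eq_square)
  show "x \<noteq> 0 \<Longrightarrow> inverse x * x = 1" "x \<noteq> 0 \<Longrightarrow> x * inverse x = 1"
    by (simp_all add: inverse_quat_def cnj)
  show "x div y = x * inverse y" by (rule divide_quat_def)
  show "inverse (0 :: quat) = 0" by (simp add: inverse_quat_def)
  have "(norm (x * y))\<^sup>2 = (norm x)\<^sup>2 * (norm y)\<^sup>2"
    unfolding nsq times_quat.sel by algebra
  then have "(norm (x * y))\<^sup>2 = (norm x * norm y)\<^sup>2"
    by (simp only: power_mult_distrib)
  then show "norm (x * y) = norm x * norm y"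
    by (rule power2_eq_imp_eq) simp_all
qed

end


section \<open>Normalised Lebesgue measure and \<open>L\<^sup>p\<close> norms\<close>

definition mu :: "'a::euclidean_space measure" where
  "mu = density lebesgue (\<lambda>_. ennreal (1 / (2 * pi) powr (real DIM('a) / 2)))"

text \<open>Only used for exponents \<open>a > 0\<close>; then \<open>0\<close> and \<open>\<infinity>\<close> are fixed.\<close>

definition ennreal_powr :: "ennreal \<Rightarrow> real \<Rightarrow> ennreal" where
  "ennreal_powr x a = (if x = \<infinity> then \<infinity> else ennreal (enn2real x powr a))"

definition Lp_norm :: "real \<Rightarrow> ('a::euclidean_space \<Rightarrow> 'b::real_normed_vector) \<Rightarrow> ennreal" where
  "Lp_norm p F = ennreal_powr (\<integral>\<^sup>+ x. ennreal (norm (F x) powr p) \<partial>mu) (1 / p)"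

definition L2 :: "('a::euclidean_space \<Rightarrow> quat) set" where
  "L2 = {f. f \<in> borel_measurable lebesgue \<and> Lp_norm 2 f < \<infinity>}"


section \<open>The two-sided quaternion windowed Fourier transform\<close>

text \<open>
  \<open>\<real>\<^sup>2\<^sup>d = \<real>\<^sup>d \<times> \<real>\<^sup>d\<close> with \<open>d = CARD('d)\<close>, and \<open>\<real>\<^sup>4\<^sup>d = \<real>\<^sup>2\<^sup>d \<times> \<real>\<^sup>2\<^sup>d\<close>;
  the library norm of a product type is the Euclidean one.
\<close>

type_synonym 'd R2d = "(real ^ 'd) \<times> (real ^ 'd)"
type_synonym 'd R4d = "'d R2d \<times> 'd R2d"

text \<open>Non-zero as an element of \<open>L\<^sup>2\<close>, i.e. modulo null sets.\<close>

definition quat_window :: "('d::finite R2d \<Rightarrow> quat) \<Rightarrow> bool" where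
  "quat_window g \<longleftrightarrow> g \<in> L2 \<and> \<not> (AE y in lebesgue. g y = 0)"

definition qwft :: "('d::finite R2d \<Rightarrow> quat) \<Rightarrow> ('d R2d \<Rightarrow> quat) \<Rightarrow> 'd R4d \<Rightarrow> quat" where
  "qwft g f = (\<lambda>(x, (u, v)).
     \<integral>y. (case y of (s, t) \<Rightarrow>
        exp (- ((s \<bullet> u) *\<^sub>R quat_i)) * f y * qcnj (g (y - x)) * exp (- ((t \<bullet> v) *\<^sub>R quat_j))) \<partial>mu)"

definition M_const :: "real \<Rightarrow> real \<Rightarrow> real \<Rightarrow> real" where
  "M_const d \<epsilon> p =
     ((2 * d + \<epsilon>) /
      (2 powr (\<epsilon> * (2 * d + 2 * p + 2) / ((2 * d + \<epsilon>) * (p + 1)))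
       * \<epsilon> powr (2 * \<epsilon> / (2 * d + \<epsilon>))
       * Gamma (2 * d) powr (\<epsilon> / ((2 * d + \<epsilon>) * (p + 1)))
       * (2 * d - \<epsilon>) powr ((2 * d - \<epsilon>) / (2 * d + \<epsilon>) + \<epsilon> / ((2 * d + \<epsilon>) * (p + 1)))))
     powr (p * (p + 1))"

end

theory Submission
  imports Defs
begin

text \<open>
  Write \<open>N = \<parallel>f\<parallel>\<^sub>2 \<parallel>g\<parallel>\<^sub>2\<close> and \<open>W\<close> for the \<open>L\<^sup>2\<close> norm of \<open>|z|\<^sup>\<epsilon> \<G>\<close>, where \<open>\<G>\<close> is the transform.
  The phases have modulus one, so Cauchy--Schwarz gives \<open>|\<G>| \<le> N\<close> pointwise; Plancherel is not
  needed. Split \<open>\<Sigma>\<close> along the ball of radius \<open>r\<close> and put \<open>\<theta> = p / (p + 1)\<close>. On both parts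
  Hoelder's inequality bounds the integral of \<open>|\<G>|\<^sup>p\<close> by \<open>N powr (p - q \<theta>) \<mu>(\<Sigma>) powr (1 - \<theta>)\<close>
  times the \<open>\<theta>\<close>-th power of the integral of \<open>|\<G>|\<^sup>q\<close>. Inside the ball take \<open>q = 1\<close> and pair
  \<open>\<G>\<close> with the weight \<open>|z| powr - \<epsilon>\<close>, which is square integrable there because \<open>2 \<epsilon> < 4 d\<close>;
  outside take \<open>q = 2\<close> and use \<open>r \<le> |z|\<close>. The sum of the two bounds is minimal at an explicit
  \<open>r\<close>, and the minimum is the stated constant.
\<close>

section \<open>Modulus of the phases\<close>

lemma norm_qcnj [simp]: "norm (qcnj x) = norm x"
  by (simp add: norm_quat_def)

lemma qcnj_mult: "qcnj (x * y) = qcnj y * qcnj x"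
  by (simp add: quat_eq_iff algebra_simps)

lemma qcnj_power: "qcnj (x ^ n) = qcnj x ^ n"
proof (induction n)
  case 0
  show ?case by (simp add: quat_eq_iff)
next
  case (Suc n)
  then show ?case by (simp add: qcnj_mult power_commutes)
qed

lemma bounded_linear_qcnj: "bounded_linear qcnj"
  unfolding linear_conv_bounded_linear [symmetric]
  by (rule linearI) (simp_all add: quat_eq_iff)

lemma qcnj_exp: "qcnj (exp x) = exp (qcnj x)"
proof -
  have "qcnj (exp x) = (\<Sum>n. qcnj (x ^ n /\<^sub>R fact n))"
    unfolding exp_def
    by (rule bounded_linear.suminf [OF bounded_linear_qcnj summable_exp_generic])
  also have "\<dots> = exp (qcnj x)"
    unfolding exp_def
    by (simp add: linear_cmul [OF bounded_linear.linear [OF bounded_linear_qcnj]] qcnj_power)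
  finally show ?thesis .
qed

text \<open>Conjugation reverses products but keeps powers, so it commutes with the exponential
  series. On a purely imaginary \<open>x\<close> it turns \<open>exp x\<close> into its inverse
  \<open>exp (- x)\<close>, and conjugates have equal norms.\<close>

lemma norm_exp_imaginary:
  assumes "qcnj x = - x"
  shows "norm (exp x) = 1"
proof -
  have "norm (exp x) * norm (exp x) = norm (exp x * exp (- x))"
    by (metis assms norm_mult norm_qcnj qcnj_exp)
  also have "\<dots> = 1"
    by (simp add: exp_minus_inverse)
  finally show ?thesis
    by (metis norm_ge_zero abs_of_nonneg abs_1 power2_eq_square real_sqrt_abs power_one)
qed

lemma norm_exp_quat_i [simp]: "norm (exp (- (a *\<^sub>R quat_i))) = 1"
  by (rule norm_exp_imaginary) (simp add: quat_eq_iff)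

lemma norm_exp_quat_j [simp]: "norm (exp (- (a *\<^sub>R quat_j))) = 1"
  by (rule norm_exp_imaginary) (simp add: quat_eq_iff)

lemma borel_measurable_qcnj [measurable]: "qcnj \<in> borel_measurable borel"
  by (intro borel_measurable_continuous_onI bounded_linear.continuous_on [OF bounded_linear_qcnj]
      continuous_intros)

text \<open>The phases use \<open>exp\<close> only along a line through 0. There it is
  differentiable in the real parameter, hence continuous.\<close>

lemma borel_measurable_exp_scaleR [measurable (raw)]:
  fixes A :: quat
  assumes [measurable]: "t \<in> borel_measurable M"
  shows "(\<lambda>x. exp (- (t x *\<^sub>R A))) \<in> borel_measurable M"
proof -
  have "isCont (\<lambda>s. exp (s *\<^sub>R A)) s" for s :: real
    by (rule has_vector_derivative_continuous [OF exp_scaleR_has_vector_derivative_right])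
  then have [measurable]: "(\<lambda>s::real. exp (s *\<^sub>R A)) \<in> borel_measurable borel"
    by (intro borel_measurable_continuous_onI) (simp add: continuous_on_eq_continuous_at)
  have "(\<lambda>x. exp ((- t x) *\<^sub>R A)) \<in> borel_measurable M"
    by (rule measurable_compose [where g = "\<lambda>s::real. exp (s *\<^sub>R A)"]) measurable
  then show ?thesis
    by simp
qed

section \<open>Lebesgue measurable functions and the normalised measure\<close>

text \<open>Each coordinate is a real function and has an \<open>M\<close>-measurable version. The
  basis is finite, so the exceptional null sets unite to a null set and the coordinates can be
  reassembled.\<close>

lemma completion_ex_borel_measurable_euclidean:
  fixes f :: "'a \<Rightarrow> 'b::euclidean_space"
  assumes [measurable]: "f \<in> borel_measurable (completion M)"
  obtains f' where "f' \<in> borel_measurable M" "AE x in M. f x = f' x"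
proof -
  have "\<forall>b. \<exists>h\<in>borel_measurable M. AE x in M. f x \<bullet> b = h x"
    by (auto intro!: completion_ex_borel_measurable_real)
  then obtain h where h [measurable]: "\<And>b. h b \<in> borel_measurable M"
    and eq: "\<And>b. AE x in M. f x \<bullet> b = h b x"
    by metis
  have "AE x in M. \<forall>b\<in>Basis. f x \<bullet> b = h b x"
    using eq by (simp add: AE_finite_all)
  then have "AE x in M. f x = (\<Sum>b\<in>Basis. h b x *\<^sub>R b)"
    by eventually_elim (metis (no_types, lifting) euclidean_representation sum.cong)
  then show thesis
    by (intro that [of "\<lambda>x. \<Sum>b\<in>Basis. h b x *\<^sub>R b"]) measurable
qed

text \<open>Preimages of one set under the two functions differ only within a null set, and
  completeness makes such a modification measurable.\<close>

lemma (in complete_measure) measurable_cong_AE: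
  assumes "AE x in M. f x = g x" and [measurable]: "g \<in> measurable M N"
    and "f \<in> space M \<rightarrow> space N"
  shows "f \<in> measurable M N"
proof (rule measurableI)
  show "f x \<in> space N" if "x \<in> space M" for x
    using assms(3) that by auto
  show "f -` A \<inter> space M \<in> sets M" if [measurable]: "A \<in> sets N" for A
  proof (rule in_sets_AE)
    show "AE x in M. (x \<in> g -` A \<inter> space M) = (x \<in> f -` A \<inter> space M)"
      using assms(1) by eventually_elim auto
  qed (use assms(3) in auto)
qed

section \<open>Translation invariance of Lebesgue measure\<close>

lemma AE_lborel_translate:
  fixes a :: "'a::euclidean_space"
  assumes "AE x in lborel. P x"
  shows "AE x in lborel. P (x - a)"
proof -
  \<comment> \<open>The exceptional set itself need not be measurable; the Borel null set
    \<open>N\<close> around it is what gets translated.\<close>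
  obtain N where N: "N \<in> null_sets lborel" "{x. \<not> P x} \<subseteq> N"
    using assms by (auto simp: eventually_ae_filter)
  then have [measurable]: "N \<in> sets borel" by auto
  have "AE x in lborel. x \<notin> N"
    using N by (intro AE_not_in)
  then have "AE x in distr lborel borel ((+) (- a)). x \<notin> N"
    by (subst lborel_distr_plus)
  then have "AE x in lborel. - a + x \<notin> N"
    by (subst (asm) AE_distr_iff) auto
  then show ?thesis
    by (rule eventually_mono) (use N in \<open>auto simp: algebra_simps\<close>)
qed

lemma nn_integral_lborel_translate:
  fixes a :: "'a::euclidean_space"
  assumes [measurable]: "f \<in> borel_measurable borel"
  shows "(\<integral>\<^sup>+x. f (x - a) \<partial>lborel) = (\<integral>\<^sup>+x. f x \<partial>lborel)"
proof -
  have "(\<integral>\<^sup>+x. f x \<partial>lborel) = (\<integral>\<^sup>+x. f x \<partial>distr lborel borel ((+) (- a)))"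
    by (simp add: lborel_distr_plus)
  also have "\<dots> = (\<integral>\<^sup>+x. f (x - a) \<partial>lborel)"
    by (subst nn_integral_distr) (auto simp: algebra_simps)
  finally show ?thesis ..
qed

section \<open>The normalised measure as a positive multiple of Lebesgue measure\<close>

lemma space_mu [simp]: "space mu = UNIV"
  and sets_mu [simp, measurable_cong]: "sets mu = sets lebesgue"
  by (simp_all add: mu_def)

lemma borel_measurable_mu_iff [simp]: "borel_measurable mu = borel_measurable lebesgue"
  by (rule measurable_cong_sets) simp_all

lemma AE_mu_iff: "(AE x in mu. P x) \<longleftrightarrow> (AE x in lebesgue. P x)"
  unfolding mu_def by (subst AE_density) (simp_all)

lemma nn_integral_mu:
  fixes h :: "'a::euclidean_space \<Rightarrow> ennreal"
  assumes "h \<in> borel_measurable lebesgue"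
  shows "(\<integral>\<^sup>+x. h x \<partial>mu) = ennreal (1 / (2 * pi) powr (real DIM('a) / 2)) * (\<integral>\<^sup>+x. h x \<partial>lborel)"
proof -
  have "(\<integral>\<^sup>+x. h x \<partial>mu) = ennreal (1 / (2 * pi) powr (real DIM('a) / 2)) * (\<integral>\<^sup>+x. h x \<partial>lebesgue)"
    unfolding mu_def using assms by (subst nn_integral_density) (auto simp: nn_integral_cmult)
  then show ?thesis
    by (simp add: nn_integral_completion)
qed

lemma nn_integral_mu_translate:
  fixes a :: "'a::euclidean_space"
  assumes [measurable]: "f \<in> borel_measurable borel"
  shows "(\<integral>\<^sup>+x. f (x - a) \<partial>mu) = (\<integral>\<^sup>+x. f x \<partial>mu)"
proof -
  have [measurable]: "f \<in> borel_measurable lborel" "(\<lambda>x. f (x - a)) \<in> borel_measurable lborel"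
    by simp_all
  show ?thesis
    by (simp add: nn_integral_mu measurable_completion nn_integral_lborel_translate)
qed

section \<open>Squares and real powers of extended nonnegative numbers\<close>

lemma ennreal_power2_le_iff: "x\<^sup>2 \<le> y\<^sup>2 \<longleftrightarrow> x \<le> y" for x y :: ennreal
  by (cases x; cases y) (auto simp: ennreal_power top_unique power2_le_iff_abs_le)

lemma ennreal_powr_ennreal: "0 \<le> a \<Longrightarrow> ennreal_powr (ennreal a) b = ennreal (a powr b)"
  by (simp add: ennreal_powr_def)

lemma ennreal_powr_top [simp]: "ennreal_powr top b = top"
  by (simp add: ennreal_powr_def)

text \<open>Squaring removes the root even when the integral is infinite, so quadratic norms can be
  handled as squared inequalities in \<open>ennreal\<close> without finiteness hypotheses.\<close>

lemma Lp_norm_2_power2: "(Lp_norm 2 F)\<^sup>2 = (\<integral>\<^sup>+x. (ennreal (norm (F x)))\<^sup>2 \<partial>mu)"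
proof -
  have "(ennreal_powr X (1 / 2))\<^sup>2 = X" for X
    by (cases X) (auto simp: ennreal_powr_ennreal ennreal_power powr_half_sqrt)
  then show ?thesis
    by (simp add: Lp_norm_def ennreal_power)
qed

section \<open>Measurability and boundedness of the transform\<close>

text \<open>The integrand of the transform. The points \<open>z\<close> and \<open>y\<close> are
  taken apart by projections, so that measurability in the pair can be stated.\<close>

definition qkernel :: "('d::finite R2d \<Rightarrow> quat) \<Rightarrow> ('d R2d \<Rightarrow> quat) \<Rightarrow> 'd R4d \<Rightarrow> 'd R2d \<Rightarrow> quat" where
  "qkernel g f z y = exp (- ((fst y \<bullet> fst (snd z)) *\<^sub>R quat_i)) * f y * qcnj (g (y - fst z))
     * exp (- ((snd y \<bullet> snd (snd z)) *\<^sub>R quat_j))"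

lemma qwft_eq_qkernel: "qwft g f z = (\<integral>y. qkernel g f z y \<partial>mu)"
  by (cases z) (simp add: qwft_def qkernel_def split_beta)

lemma norm_qkernel: "norm (qkernel g f z y) = norm (f y) * norm (g (y - fst z))"
  by (simp add: qkernel_def norm_mult)

lemma borel_measurable_qkernel:
  fixes f g :: "'d::finite R2d \<Rightarrow> quat"
  assumes [measurable]: "f \<in> borel_measurable borel" "g \<in> borel_measurable borel"
  shows "(\<lambda>(z, y). qkernel g f z y) \<in> borel_measurable (borel \<Otimes>\<^sub>M borel)"
proof -
  have [measurable]: "(\<lambda>p :: 'd R4d \<times> 'd R2d. fst (fst p)) \<in> borel_measurable (borel \<Otimes>\<^sub>M borel)"
    "(\<lambda>p :: 'd R4d \<times> 'd R2d. fst (snd (fst p))) \<in> borel_measurable (borel \<Otimes>\<^sub>M borel)"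
    "(\<lambda>p :: 'd R4d \<times> 'd R2d. snd (snd (fst p))) \<in> borel_measurable (borel \<Otimes>\<^sub>M borel)"
    "(\<lambda>p :: 'd R4d \<times> 'd R2d. fst (snd p)) \<in> borel_measurable (borel \<Otimes>\<^sub>M borel)"
    "(\<lambda>p :: 'd R4d \<times> 'd R2d. snd (snd p)) \<in> borel_measurable (borel \<Otimes>\<^sub>M borel)"
    unfolding borel_prod by (intro borel_measurable_continuous_onI continuous_intros)+
  show ?thesis
    unfolding qkernel_def split_beta by measurable
qed

lemma integral_mu:
  fixes h :: "'a::euclidean_space \<Rightarrow> quat"
  assumes "h \<in> borel_measurable borel"
  shows "(\<integral>x. h x \<partial>mu) = (1 / (2 * pi) powr (real DIM('a) / 2)) *\<^sub>R (\<integral>x. h x \<partial>lborel)"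
proof -
  have "h \<in> borel_measurable lborel"
    using assms by simp
  then have "h \<in> borel_measurable lebesgue"
    by (rule measurable_completion)
  then have "(\<integral>x. h x \<partial>mu) = (\<integral>x. (1 / (2 * pi) powr (real DIM('a) / 2)) *\<^sub>R h x \<partial>lebesgue)"
    unfolding mu_def by (subst integral_density) auto
  also have "\<dots> = (1 / (2 * pi) powr (real DIM('a) / 2)) *\<^sub>R (\<integral>x. h x \<partial>lebesgue)"
    by simp
  also have "(\<integral>x. h x \<partial>lebesgue) = (\<integral>x. h x \<partial>lborel)"
    using \<open>h \<in> borel_measurable lborel\<close> by (rule integral_completion)
  finally show ?thesis .
qed

text \<open>Joint measurability of the kernel is established for Borel functions, so
  \<open>f\<close> and \<open>g\<close> are replaced by Borel versions. A translate of a null set is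
  null, so for each fixed \<open>z\<close> the kernel changes only on a null set of
  \<open>y\<close>; the transform is therefore unchanged at every point, not just almost
  everywhere.\<close>

lemma qwft_ex_borel:
  fixes f g :: "'d::finite R2d \<Rightarrow> quat"
  assumes [measurable]: "f \<in> borel_measurable lebesgue" "g \<in> borel_measurable lebesgue"
  obtains f' g' where "f' \<in> borel_measurable borel" "g' \<in> borel_measurable borel"
    "AE y in mu. f y = f' y" "AE y in mu. g y = g' y"
    "qwft g f = qwft g' f'"
proof -
  obtain f' where f': "f' \<in> borel_measurable lborel" and f: "AE y in lborel. f y = f' y"
    using assms(1) by (rule completion_ex_borel_measurable_euclidean)
  obtain g' where g': "g' \<in> borel_measurable lborel" and g: "AE y in lborel. g y = g' y"
    using assms(2) by (rule completion_ex_borel_measurable_euclidean)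
  show thesis
  proof (rule that [of f' g'])
    show [measurable]: "f' \<in> borel_measurable borel" "g' \<in> borel_measurable borel"
      using f' g' by simp_all
    show "AE y in mu. f y = f' y" "AE y in mu. g y = g' y"
      using f g by (simp_all add: AE_mu_iff AE_completion)
    show "qwft g f = qwft g' f'"
    proof
      fix z :: "'d R4d"
      have "AE y in lborel. qkernel g f z y = qkernel g' f' z y"
        using f AE_lborel_translate [OF g, of "fst z"]
        by eventually_elim (simp add: qkernel_def)
      then have AE: "AE y in mu. qkernel g f z y = qkernel g' f' z y"
        by (simp add: AE_mu_iff AE_completion)
      have "case_prod (qkernel g' f') \<in> borel_measurable (borel \<Otimes>\<^sub>M borel)"
        by (rule borel_measurable_qkernel) simp_all
      then have "(\<lambda>y. qkernel g' f' z y) \<in> borel_measurable lborel"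
        by (auto dest: measurable_Pair2 [where x = z])
      then have m: "qkernel g' f' z \<in> borel_measurable lebesgue"
        by (simp add: measurable_completion)
      \<comment> \<open>Congruence of the Bochner integrals asks for both kernels to be measurable;
        the original one gets this from completeness.\<close>
      then have "qkernel g f z \<in> borel_measurable lebesgue"
        using AE by (intro completion.measurable_cong_AE [of "qkernel g f z" "qkernel g' f' z"]) (simp_all add: AE_mu_iff)
      then show "qwft g f z = qwft g' f' z"
        unfolding qwft_eq_qkernel using AE m by (intro integral_cong_AE) simp_all
    qed
  qed
qed

lemma borel_measurable_qwft:
  fixes f g :: "'d::finite R2d \<Rightarrow> quat"
  assumes "f \<in> borel_measurable lebesgue" "g \<in> borel_measurable lebesgue"
  shows "qwft g f \<in> borel_measurable borel"
proof -
  obtain f' g' where [measurable]: "f' \<in> borel_measurable borel" "g' \<in> borel_measurable borel"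
    and eq: "qwft g f = qwft g' f'"
    by (rule qwft_ex_borel [OF assms])
  have [measurable]: "case_prod (qkernel g' f') \<in> borel_measurable (borel \<Otimes>\<^sub>M borel)"
    by (rule borel_measurable_qkernel) simp_all
  have 1: "(\<lambda>y. qkernel g' f' z y) \<in> borel_measurable borel" for z
    using measurable_compose [OF measurable_Pair1' [of z borel borel]
      \<open>case_prod (qkernel g' f') \<in> _\<close>] by simp
  \<comment> \<open>Passing from \<open>mu\<close> to a multiple of \<open>lborel\<close> puts the
    integral in the Borel, sigma-finite setting, where it depends measurably on the parameter
    \<open>z\<close>.\<close>
  have "qwft g' f' = (\<lambda>z. (1 / (2 * pi) powr (real DIM('d R2d) / 2)) *\<^sub>R (\<integral>y. qkernel g' f' z y \<partial>lborel))"
    by (rule ext) (simp only: qwft_eq_qkernel integral_mu [OF 1])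
  also have "\<dots> \<in> borel_measurable borel"
    by (intro borel_measurable_scaleR borel_measurable_const lborel.borel_measurable_lebesgue_integral) simp
  finally show ?thesis
    by (simp add: eq)
qed

text \<open>Cauchy--Schwarz for \<open>f\<close> against a translate of \<open>g\<close>, whose norm
  is that of \<open>g\<close> by translation invariance.\<close>

lemma norm_qwft_le:
  fixes f g :: "'d::finite R2d \<Rightarrow> quat"
  assumes "f \<in> borel_measurable lebesgue" "g \<in> borel_measurable lebesgue"
  shows "ennreal (norm (qwft g f z)) \<le> Lp_norm 2 f * Lp_norm 2 g"
proof -
  obtain f' g' where [measurable]: "f' \<in> borel_measurable borel" "g' \<in> borel_measurable borel"
    and f: "AE y in mu. f y = f' y" and g: "AE y in mu. g y = g' y"
    and eq: "qwft g f = qwft g' f'"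
    by (rule qwft_ex_borel [OF assms])
  have m: "f' \<in> borel_measurable lborel" "(\<lambda>y. g' (y - fst z)) \<in> borel_measurable lborel"
    by simp_all
  have m1: "(\<lambda>y. ennreal (norm (f' y))) \<in> borel_measurable mu"
    unfolding borel_measurable_mu_iff by (rule measurable_completion) (use m in measurable)
  have m2: "(\<lambda>y. ennreal (norm (g' (y - fst z)))) \<in> borel_measurable mu"
    unfolding borel_measurable_mu_iff by (rule measurable_completion) (use m in measurable)
  \<comment> \<open>If the kernel is not integrable, its Bochner integral is 0 by default and the
    bound is trivial.\<close>
  have "ennreal (norm (qwft g' f' z)) \<le> (\<integral>\<^sup>+y. ennreal (norm (qkernel g' f' z y)) \<partial>mu)"
    unfolding qwft_eq_qkernel
    by (cases "integrable mu (qkernel g' f' z)")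
       (simp_all add: integral_norm_bound_ennreal not_integrable_integral_eq)
  also have "\<dots> = (\<integral>\<^sup>+y. ennreal (norm (f' y)) * ennreal (norm (g' (y - fst z))) \<partial>mu)"
    by (simp add: norm_qkernel ennreal_mult)
  finally have "(ennreal (norm (qwft g' f' z)))\<^sup>2
      \<le> (\<integral>\<^sup>+y. ennreal (norm (f' y)) * ennreal (norm (g' (y - fst z))) \<partial>mu)\<^sup>2"
    by (simp add: power_mono)
  also have "\<dots> \<le> (\<integral>\<^sup>+y. (ennreal (norm (f' y)))\<^sup>2 \<partial>mu) * (\<integral>\<^sup>+y. (ennreal (norm (g' (y - fst z))))\<^sup>2 \<partial>mu)"
    by (rule Cauchy_Schwarz_nn_integral [OF m1 m2])
  also have "(\<integral>\<^sup>+y. (ennreal (norm (g' (y - fst z))))\<^sup>2 \<partial>mu) = (\<integral>\<^sup>+y. (ennreal (norm (g' y)))\<^sup>2 \<partial>mu)"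
    by (rule nn_integral_mu_translate [where f = "\<lambda>y. (ennreal (norm (g' y)))\<^sup>2"]) simp
  also have "(\<integral>\<^sup>+y. (ennreal (norm (f' y)))\<^sup>2 \<partial>mu) = (Lp_norm 2 f)\<^sup>2"
    unfolding Lp_norm_2_power2 using f by (intro nn_integral_cong_AE) auto
  also have "(\<integral>\<^sup>+y. (ennreal (norm (g' y)))\<^sup>2 \<partial>mu) = (Lp_norm 2 g)\<^sup>2"
    unfolding Lp_norm_2_power2 using g by (intro nn_integral_cong_AE) auto
  finally have "(ennreal (norm (qwft g f z)))\<^sup>2 \<le> (Lp_norm 2 f * Lp_norm 2 g)\<^sup>2"
    by (simp add: eq power_mult_distrib)
  then show ?thesis
    by (simp add: ennreal_power2_le_iff)
qed

section \<open>Radial integrals\<close>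

lemma nn_integral_powr_from_0:
  fixes a c :: real
  assumes "a > -1" "c \<ge> 0"
  shows "(\<integral>\<^sup>+t. ennreal (indicator {0..c} t * t powr a) \<partial>lborel) = ennreal (c powr (a + 1) / (a + 1))"
  by (rule nn_integral_has_integral_lebesgue [OF _ has_integral_powr_from_0 [OF assms]]) simp

lemma nn_integral_powr_Icc:
  fixes a x r :: real
  assumes "0 < a" "0 < x" "x \<le> r"
  shows "(\<integral>\<^sup>+t. ennreal (a * t powr (- a - 1)) * indicator {x..r} t \<partial>lborel)
    = ennreal (x powr - a - r powr - a)"
proof -
  have "(\<integral>\<^sup>+t. ennreal (a * t powr (- a - 1)) * indicator {x..r} t \<partial>lborel)
      = ennreal ((- (r powr - a)) - (- (x powr - a)))"
    using assms
    by (intro nn_integral_FTC_Icc) (auto intro!: derivative_eq_intros)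
  then show ?thesis by simp
qed

text \<open>Layer cake: for \<open>0 < |z| < r\<close>, \<open>|z|\<^sup>-\<^sup>a\<close> is \<open>r\<^sup>-\<^sup>a\<close> plus the integral
  of \<open>a t\<^sup>-\<^sup>a\<^sup>-\<^sup>1\<close> over \<open>|z| \<le> t \<le> r\<close>.\<close>

lemma nn_integral_norm_powr_cball:
  fixes a r :: real
  assumes a: "0 < a" "a < real DIM('a)" and r: "0 < r"
  shows "(\<integral>\<^sup>+z. ennreal (norm z powr - a) * indicator (cball 0 r) z \<partial>(lborel :: 'a::euclidean_space measure))
    = ennreal (unit_ball_vol DIM('a) * (real DIM('a) / (real DIM('a) - a)) * r powr (real DIM('a) - a))"
proof -
  define n where "n = real DIM('a)"
  define V where "V = unit_ball_vol n"
  have n: "a < n" "0 < n" and V: "0 \<le> V"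
    using a by (auto simp: n_def V_def)
  have ball: "emeasure lborel (cball (0 :: 'a) t) = ennreal (V * t powr n)" if "0 \<le> t" for t
    using that emeasure_cball [OF that, of "0 :: 'a"]
    by (cases "t = 0") (simp_all add: V_def n_def powr_realpow)
  define K where "K z t = ennreal (a * t powr (- a - 1)) * indicator {norm z..r} t" for z :: 'a and t
  \<comment> \<open>The region of integration is closed in the product, which makes \<open>K\<close>
    jointly measurable, as Tonelli's theorem demands.\<close>
  have "closed {p :: 'a \<times> real. norm (fst p) \<le> snd p \<and> snd p \<le> r}"
    by (intro closed_Collect_conj closed_Collect_le continuous_intros)
  moreover have "sets (lborel \<Otimes>\<^sub>M lborel) = sets (borel :: ('a \<times> real) measure)"
    by (simp only: lborel_prod sets_lborel)
  ultimately have [measurable]: "{p :: 'a \<times> real. norm (fst p) \<le> snd p \<and> snd p \<le> r} \<in> sets (lborel \<Otimes>\<^sub>M lborel)"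
    by (simp only: borel_closed)
  have "(\<lambda>p :: 'a \<times> real. ennreal (a * snd p powr (- a - 1))
      * indicator {p. norm (fst p) \<le> snd p \<and> snd p \<le> r} p) \<in> borel_measurable (lborel \<Otimes>\<^sub>M lborel)"
    by (intro borel_measurable_times_ennreal borel_measurable_indicator) measurable
  also have "(\<lambda>p :: 'a \<times> real. ennreal (a * snd p powr (- a - 1)) * indicator {p. norm (fst p) \<le> snd p \<and> snd p \<le> r} p)
    = case_prod K"
    by (auto simp: fun_eq_iff K_def split: split_indicator)
  finally have meas: "case_prod K \<in> borel_measurable (lborel \<Otimes>\<^sub>M lborel)" .
  have ball_integral: "(\<integral>\<^sup>+z. ennreal (r powr - a) * indicator (cball (0 :: 'a) r) z \<partial>lborel)
      = ennreal (r powr - a) * emeasure lborel (cball (0 :: 'a) r)"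
    by (rule nn_integral_cmult_indicator) simp
  have "(\<integral>\<^sup>+z. ennreal (norm z powr - a) * indicator (cball 0 r) z \<partial>(lborel :: 'a measure))
    = (\<integral>\<^sup>+z. ennreal (r powr - a) * indicator (cball 0 r) z
        + (\<integral>\<^sup>+t. K z t \<partial>lborel) \<partial>(lborel :: 'a measure))"
  proof (rule nn_integral_cong_AE)
    \<comment> \<open>The identity fails at the origin, where \<open>0 powr - a\<close> is 0 while
      the integral over \<open>t\<close> diverges; a single point is a null set.\<close>
    show "AE z :: 'a in lborel. ennreal (norm z powr - a) * indicator (cball 0 r) z
      = ennreal (r powr - a) * indicator (cball 0 r) z
        + (\<integral>\<^sup>+t. K z t \<partial>lborel)"
      using AE_lborel_singleton [of "0 :: 'a"]
    proof eventually_elim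
      case (elim z)
      show ?case
      proof (cases "norm z \<le> r")
        case True
        have "ennreal (norm z powr - a) = ennreal (r powr - a) + ennreal (norm z powr - a - r powr - a)"
          using True elim a by (subst ennreal_plus [symmetric]) (auto intro: powr_mono2')
        then show ?thesis
          using True elim a by (simp add: K_def nn_integral_powr_Icc)
      qed (simp add: K_def)
    qed
  qed
  also have "\<dots> = ennreal (r powr - a) * emeasure lborel (cball (0 :: 'a) r)
      + (\<integral>\<^sup>+z. (\<integral>\<^sup>+t. K z t \<partial>lborel) \<partial>(lborel :: 'a measure))"
  proof -
    have 1: "(\<lambda>z :: 'a. ennreal (r powr - a) * indicator (cball 0 r) z) \<in> borel_measurable lborel"
      by (intro borel_measurable_times_ennreal borel_measurable_const borel_measurable_indicator) (simp only: sets_lborel borel_closed closed_cball)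
    have 2: "(\<lambda>z :: 'a. \<integral>\<^sup>+t. K z t \<partial>lborel) \<in> borel_measurable lborel"
      by (rule lborel.borel_measurable_nn_integral [OF meas])
    show ?thesis
      unfolding nn_integral_add [OF 1 2] ball_integral ..
  qed
  also have "(\<integral>\<^sup>+z. (\<integral>\<^sup>+t. K z t \<partial>lborel) \<partial>(lborel :: 'a measure))
      = (\<integral>\<^sup>+t. (\<integral>\<^sup>+z. K z t \<partial>(lborel :: 'a measure)) \<partial>lborel)"
    by (rule lborel_pair.Fubini' [OF meas, symmetric])
  \<comment> \<open>For fixed \<open>t\<close> the variable \<open>z\<close> runs over the ball of
    radius \<open>t\<close>, of measure \<open>V * t powr n\<close>. The remaining power of
    \<open>t\<close> is integrable at 0 because \<open>a < n\<close>.\<close>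
  also have "\<dots> = (\<integral>\<^sup>+t. ennreal (a * V) * ennreal (indicator {0..r} t * t powr (n - a - 1)) \<partial>lborel)"
  proof (rule nn_integral_cong)
    fix t :: real
    have "(\<integral>\<^sup>+z. K z t \<partial>(lborel :: 'a measure))
      = (\<integral>\<^sup>+z. ennreal (a * t powr (- a - 1)) * indicator {..r} t * indicator (cball 0 t) z \<partial>(lborel :: 'a measure))"
      by (intro nn_integral_cong) (auto simp: K_def split: split_indicator)
    also have "\<dots> = ennreal (a * t powr (- a - 1)) * indicator {..r} t * emeasure lborel (cball (0 :: 'a) t)"
      by (simp add: nn_integral_cmult_indicator)
    also have "\<dots> = ennreal (a * V) * ennreal (indicator {0..r} t * t powr (n - a - 1))"
    proof (cases "0 \<le> t \<and> t \<le> r")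
      case True
      have "t powr (- a - 1) * t powr n = t powr (n - a - 1)"
        by (simp add: algebra_simps flip: powr_add)
      then have "a * t powr (- a - 1) * (V * t powr n) = a * V * t powr (n - a - 1)"
        by (simp add: mult_ac)
      moreover have "ennreal (a * t powr (- a - 1)) * ennreal (V * t powr n)
          = ennreal (a * t powr (- a - 1) * (V * t powr n))"
        using a V by (intro ennreal_mult [symmetric]) simp_all
      moreover have "ennreal (a * V) * ennreal (t powr (n - a - 1)) = ennreal (a * V * t powr (n - a - 1))"
        using a V by (intro ennreal_mult [symmetric]) simp_all
      ultimately have "ennreal (a * t powr (- a - 1)) * ennreal (V * t powr n)
          = ennreal (a * V) * ennreal (t powr (n - a - 1))"
        by (simp only:)
      then show ?thesis
        using True by (simp add: ball)
    qed (auto simp: not_le)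
    finally show "(\<integral>\<^sup>+z. K z t \<partial>(lborel :: 'a measure))
      = ennreal (a * V) * ennreal (indicator {0..r} t * t powr (n - a - 1))" .
  qed
  also have "\<dots> = ennreal (a * V) * ennreal (r powr (n - a) / (n - a))"
    using nn_integral_powr_from_0 [of "n - a - 1" r] n r by (simp add: nn_integral_cmult)
  \<comment> \<open>The boundary term and the integral combine through
    \<open>1 + a / (n - a) = n / (n - a)\<close>.\<close>
  also have "ennreal (r powr - a) * emeasure lborel (cball (0 :: 'a) r) + ennreal (a * V) * ennreal (r powr (n - a) / (n - a))
      = ennreal (V * (n / (n - a)) * r powr (n - a))"
  proof -
    have "r powr - a * (V * r powr n) + a * V * (r powr (n - a) / (n - a))
      = V * (n / (n - a)) * r powr (n - a)"
      using n r by (simp add: field_simps powr_diff powr_minus)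
    moreover have "ennreal (r powr - a) * ennreal (V * r powr n) = ennreal (r powr - a * (V * r powr n))"
      using V by (intro ennreal_mult [symmetric]) simp_all
    moreover have "ennreal (a * V) * ennreal (r powr (n - a) / (n - a)) = ennreal (a * V * (r powr (n - a) / (n - a)))"
      using a n V by (intro ennreal_mult [symmetric]) simp_all
    moreover have "0 \<le> r powr - a * (V * r powr n)" "0 \<le> a * V * (r powr (n - a) / (n - a))"
      using a n V by simp_all
    ultimately show ?thesis
      using r by (simp add: ball flip: ennreal_plus)
  qed
  finally show ?thesis
    by (simp add: V_def n_def)
qed

section \<open>Concentration\<close>

text \<open>Hoelder's inequality with exponents \<open>1 / \<theta>\<close> and
  \<open>1 / (1 - \<theta>)\<close>, after bounding \<open>h z powr p\<close> by
  \<open>N powr (p - q * \<theta>) * (h z powr q) powr \<theta>\<close>. It is derived pointwise,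
  from Young's inequality for \<open>h z powr q\<close> and a constant \<open>m\<close>.\<close>

lemma nn_integral_indicator_powr_le:
  fixes h :: "'a \<Rightarrow> real"
  assumes h: "h \<in> borel_measurable M" "\<And>z. 0 \<le> h z" "\<And>z. h z \<le> N"
    and E: "E \<in> sets M" "emeasure M E \<le> ennreal S"
    and \<theta>: "0 < \<theta>" "\<theta> < 1" and q: "0 < q" "q * \<theta> \<le> p"
    and pos: "0 < N" "0 < S" "0 < K"
    and K: "(\<integral>\<^sup>+z. ennreal (h z powr q) * indicator E z \<partial>M) \<le> ennreal K"
  shows "(\<integral>\<^sup>+z. ennreal (h z powr p) * indicator E z \<partial>M)
    \<le> ennreal (N powr (p - q * \<theta>) * S powr (1 - \<theta>) * K powr \<theta>)"
proof -
  \<comment> \<open>Integrating Young's inequality gives a bound for every \<open>m > 0\<close>, and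
    \<open>K / S\<close> minimises it: the two terms become the fractions \<theta> and
    \<open>1 - \<theta>\<close> of \<open>C * K\<close>. The power of \<open>m\<close> in
    \<open>C\<close> compensates the factor \<open>m powr (1 - \<theta>)\<close>.\<close>
  define m where "m = K / S"
  define C where "C = N powr (p - q * \<theta>) * m powr (\<theta> - 1)"
  have m: "0 < m" and C: "0 \<le> C"
    using pos by (auto simp: m_def C_def)
  have pw: "h z powr p \<le> C * \<theta> * (h z powr q) + C * (1 - \<theta>) * m" for z
  proof (cases "h z = 0")
    case True
    then show ?thesis
      using m C \<theta> by simp
  next
    case False
    then have hz: "0 < h z"
      using h(2) [of z] by simp
    have "h z powr p = h z powr (p - q * \<theta>) * (h z powr q) powr \<theta>"
      by (simp add: powr_powr flip: powr_add)
    also have "\<dots> \<le> N powr (p - q * \<theta>) * (h z powr q) powr \<theta>"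
      using h(3) [of z] hz q by (intro mult_right_mono powr_mono2) auto
    also have "\<dots> = C * ((h z powr q) powr \<theta> * m powr (1 - \<theta>))"
      using m by (simp add: C_def flip: powr_add)
    also have "\<dots> \<le> C * (\<theta> * (h z powr q) + (1 - \<theta>) * m)"
      using hz m \<theta> by (intro mult_left_mono Youngs_inequality_0 C) auto
    finally show ?thesis
      by (simp add: algebra_simps)
  qed
  have "(\<integral>\<^sup>+z. ennreal (h z powr p) * indicator E z \<partial>M)
    \<le> (\<integral>\<^sup>+z. ennreal (C * \<theta>) * (ennreal (h z powr q) * indicator E z)
        + ennreal (C * (1 - \<theta>) * m) * indicator E z \<partial>M)"
  proof (rule nn_integral_mono)
    fix z
    have "ennreal (h z powr p) \<le> ennreal (C * \<theta> * (h z powr q) + C * (1 - \<theta>) * m)"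
      by (rule ennreal_leI [OF pw])
    also have "\<dots> = ennreal (C * \<theta>) * ennreal (h z powr q) + ennreal (C * (1 - \<theta>) * m)"
      using C \<theta> m by (simp add: ennreal_mult)
    finally show "ennreal (h z powr p) * indicator E z
      \<le> ennreal (C * \<theta>) * (ennreal (h z powr q) * indicator E z)
        + ennreal (C * (1 - \<theta>) * m) * indicator E z"
      by (auto split: split_indicator)
  qed
  also have "\<dots> = ennreal (C * \<theta>) * (\<integral>\<^sup>+z. ennreal (h z powr q) * indicator E z \<partial>M)
      + ennreal (C * (1 - \<theta>) * m) * emeasure M E"
  proof -
    have 1: "(\<lambda>z. ennreal (h z powr q) * indicator E z) \<in> borel_measurable M"
      using h(1) E(1) by measurable
    have 2: "(\<lambda>z. ennreal (C * (1 - \<theta>) * m) * indicator E z) \<in> borel_measurable M"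
      using E(1) by measurable
    show ?thesis
      using 1 2 E(1) by (simp add: nn_integral_add nn_integral_cmult nn_integral_cmult_indicator)
  qed
  also have "\<dots> \<le> ennreal (C * \<theta>) * ennreal K + ennreal (C * (1 - \<theta>) * m) * ennreal S"
    by (intro add_mono mult_left_mono K E(2)) auto
  also have "\<dots> = ennreal (C * \<theta> * K + C * (1 - \<theta>) * m * S)"
    using C \<theta> m pos by (simp add: ennreal_mult)
  also have "C * \<theta> * K + C * (1 - \<theta>) * m * S = C * K"
    using pos by (simp add: m_def algebra_simps)
  also have "C * K = N powr (p - q * \<theta>) * S powr (1 - \<theta>) * K powr \<theta>"
    using pos by (simp add: C_def m_def powr_diff powr_divide field_simps)
  finally show ?thesis .
qed

section \<open>Choice of the radius and the resulting constant\<close>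

text \<open>At the zero of the derivative the two terms stand in the ratio \<beta> to \<alpha>,
  which gives the closed form of the minimum.\<close>

lemma powr_tradeoff_optimum:
  fixes \<alpha> \<beta> A B :: real
  assumes "0 < \<alpha>" "0 < \<beta>" "0 < A" "0 < B"
  defines "u \<equiv> \<alpha> / (\<alpha> + \<beta>)" and "v \<equiv> \<beta> / (\<alpha> + \<beta>)"
  obtains \<rho> where "0 < \<rho>"
    "A * \<rho> powr \<alpha> + B * \<rho> powr - \<beta> = (\<alpha> + \<beta>) * (A powr v * B powr u / (\<beta> powr v * \<alpha> powr u))"
proof
  \<comment> \<open>The solution of \<open>\<alpha> * A * \<rho> powr \<alpha> = \<beta> * B *
    \<rho> powr - \<beta>\<close>.\<close>
  define \<rho> where "\<rho> = (B * \<beta> / (A * \<alpha>)) powr (1 / (\<alpha> + \<beta>))"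
  have uv: "u = 1 - v"
    using assms by (simp add: u_def v_def field_simps)
  show "0 < \<rho>"
    using assms by (simp add: \<rho>_def)
  have 1: "\<rho> powr \<alpha> = (B * \<beta> / (A * \<alpha>)) powr u" and 2: "\<rho> powr - \<beta> = (B * \<beta> / (A * \<alpha>)) powr - v"
    by (simp_all add: \<rho>_def powr_powr u_def v_def)
  have "A * \<rho> powr \<alpha> = \<beta> * (A powr v * B powr u / (\<beta> powr v * \<alpha> powr u))"
    unfolding 1 using assms(1-4) by (simp add: uv powr_diff powr_mult powr_divide field_simps)
  moreover have "B * \<rho> powr - \<beta> = \<alpha> * (A powr v * B powr u / (\<beta> powr v * \<alpha> powr u))"
    unfolding 2 using assms(1-4) by (simp add: uv powr_minus powr_diff powr_mult powr_divide field_simps)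
  ultimately show "A * \<rho> powr \<alpha> + B * \<rho> powr - \<beta>
      = (\<alpha> + \<beta>) * (A powr v * B powr u / (\<beta> powr v * \<alpha> powr u))"
    by (simp add: distrib_right add_divide_distrib)
qed

text \<open>Splitting one factor off each power leaves the exponent \<open>p - 1 \<ge> 0\<close>; by
  monotonicity both remaining powers are at most \<open>(a + b) powr (p - 1)\<close>.\<close>

lemma add_powr_le_powr_add:
  fixes a b p :: real
  assumes "0 \<le> a" "0 \<le> b" "1 \<le> p"
  shows "a powr p + b powr p \<le> (a + b) powr p"
proof (cases "a + b = 0")
  case False
  then have s: "0 < a + b" using assms by linarith
  have *: "x powr p = x * x powr (p - 1)" if "0 \<le> x" for x :: real
    using that by (cases "x = 0") (simp_all add: powr_diff)
  have "a powr p + b powr p \<le> a * (a + b) powr (p - 1) + b * (a + b) powr (p - 1)"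
    using assms by (subst (1 2) *) (auto intro!: add_mono mult_left_mono powr_mono2)
  also have "\<dots> = (a + b) powr p"
    using s by (simp add: * distrib_right)
  finally show ?thesis .
qed (use assms in \<open>simp add: add_nonneg_eq_0_iff\<close>)

text \<open>The \<open>mu\<close>-integral of \<open>norm z powr - (2 * \<epsilon>)\<close> over the
  unit ball of a space of dimension \<open>4 * d\<close>.\<close>

definition weight_const :: "real \<Rightarrow> real \<Rightarrow> real" where
  "weight_const d \<epsilon> = 1 / (2 powr (2 * d) * Gamma (2 * d) * (2 * d - \<epsilon>))"

lemma weight_const_pos: "0 < d \<Longrightarrow> \<epsilon> < 2 * d \<Longrightarrow> 0 < weight_const d \<epsilon>"
  by (simp add: weight_const_def)

lemma M_const_pos:
  assumes "0 < \<epsilon>" "\<epsilon> < 2 * d"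
  shows "0 < M_const d \<epsilon> p"
proof -
  have "Gamma (2 * d) \<noteq> 0"
    using assms by (intro Gamma_real_pos [THEN less_imp_neq, symmetric]) simp
  then show ?thesis
    using assms by (simp add: M_const_def)
qed

text \<open>\<open>A\<close> and \<open>B\<close> are the coefficients of the bounds inside and
  outside the ball, after extracting p-th roots and writing the radius as
  \<open>\<rho> powr (p + 1)\<close>. Both sides are positive, so it suffices to compare logarithms,
  and this is a rational identity with the logarithms of the parameters as indeterminates.\<close>

lemma optimum_eq_M_const:
  fixes d \<epsilon> p N W S :: real
  assumes "0 < \<epsilon>" "\<epsilon> < 2 * d" "1 \<le> p" "0 < N" "0 < W" "0 < S"
  defines "\<alpha> \<equiv> 2 * d - \<epsilon>" and "\<beta> \<equiv> 2 * \<epsilon>"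
  defines "A \<equiv> S powr (1 / (p * (p + 1))) * N powr (p / (p + 1)) * W powr (1 / (p + 1))
      * weight_const d \<epsilon> powr (1 / (2 * (p + 1)))"
    and "B \<equiv> S powr (1 / (p * (p + 1))) * N powr ((p - 1) / (p + 1)) * W powr (2 / (p + 1))"
  shows "((\<alpha> + \<beta>) * (A powr (\<beta> / (\<alpha> + \<beta>)) * B powr (\<alpha> / (\<alpha> + \<beta>))
        / (\<beta> powr (\<beta> / (\<alpha> + \<beta>)) * \<alpha> powr (\<alpha> / (\<alpha> + \<beta>))))) powr (p * (p + 1))
    = M_const d \<epsilon> p * S * W powr (4 * p * d / (2 * d + \<epsilon>))
        * N powr (p * (p - (2 * d - \<epsilon>) / (2 * d + \<epsilon>)))" (is "?L = ?R")
proof -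
  define G where "G = Gamma (2 * d)"
  have G: "0 < G"
    using assms(1,2) by (simp add: G_def)
  have nz: "2 * d + \<epsilon> \<noteq> 0" "p + 1 \<noteq> 0" "p \<noteq> 0" "0 < d" "0 < 2 * d - \<epsilon>" "0 < 2 * d + \<epsilon>"
    using assms by auto
  have c: "0 < weight_const d \<epsilon>" "ln (weight_const d \<epsilon>) = - (2 * d * ln 2 + ln G + ln (2 * d - \<epsilon>))"
    using G nz by (simp_all add: weight_const_def ln_div ln_mult flip: G_def)
  have AB: "0 < A" "0 < B" "0 < \<alpha>" "0 < \<beta>" "\<alpha> + \<beta> = 2 * d + \<epsilon>"
    using assms c by (simp_all add: A_def B_def \<alpha>_def \<beta>_def)
  have lnA: "ln A = ln S / (p * (p + 1)) + p / (p + 1) * ln N + ln W / (p + 1)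
      - (2 * d * ln 2 + ln G + ln (2 * d - \<epsilon>)) / (2 * (p + 1))"
    using assms(3-6) c(1) by (simp add: A_def ln_mult c(2) minus_divide_left)
  have lnB: "ln B = ln S / (p * (p + 1)) + (p - 1) / (p + 1) * ln N + 2 / (p + 1) * ln W"
    using assms(3-6) by (simp add: B_def ln_mult)
  have lnL: "ln ?L = p * (p + 1) * (ln (2 * d + \<epsilon>) + 2 * \<epsilon> / (2 * d + \<epsilon>) * ln A
      + (2 * d - \<epsilon>) / (2 * d + \<epsilon>) * ln B - 2 * \<epsilon> / (2 * d + \<epsilon>) * (ln 2 + ln \<epsilon>)
      - (2 * d - \<epsilon>) / (2 * d + \<epsilon>) * ln (2 * d - \<epsilon>))"
    using AB nz assms(1) unfolding AB(5)
    by (simp add: ln_mult ln_div \<alpha>_def \<beta>_def)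
  have lnR: "ln ?R = p * (p + 1) * (ln (2 * d + \<epsilon>) - \<epsilon> * (2 * d + 2 * p + 2) / ((2 * d + \<epsilon>) * (p + 1)) * ln 2
      - 2 * \<epsilon> / (2 * d + \<epsilon>) * ln \<epsilon> - \<epsilon> / ((2 * d + \<epsilon>) * (p + 1)) * ln G
      - ((2 * d - \<epsilon>) / (2 * d + \<epsilon>) + \<epsilon> / ((2 * d + \<epsilon>) * (p + 1))) * ln (2 * d - \<epsilon>))
      + ln S + 4 * p * d / (2 * d + \<epsilon>) * ln W + p * (p - (2 * d - \<epsilon>) / (2 * d + \<epsilon>)) * ln N"
    using G nz assms(1-6)
    by (simp add: M_const_def ln_mult ln_div flip: G_def)
  have "ln ?L = ln ?R"
    unfolding lnL lnR lnA lnB using nz by (simp add: divide_simps) algebra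
  moreover have "0 < ?L" "0 < ?R"
    using AB M_const_pos [OF assms(1,2)] assms(4-6) by simp_all
  ultimately show ?thesis
    by (metis ln_inj_iff)
qed

text \<open>The unit ball has volume \<open>pi powr (2 * d) / Gamma (2 * d + 1)\<close>, so the
  powers of \<open>pi\<close> cancel against the normalisation, and
  \<open>Gamma (2 * d + 1) = 2 * d * Gamma (2 * d)\<close> absorbs the dimension in the
  numerator.\<close>

lemma nn_integral_mu_norm_powr_cball:
  fixes d \<epsilon> r :: real
  assumes d: "real DIM('a::euclidean_space) = 4 * d" and \<epsilon>: "0 < \<epsilon>" "\<epsilon> < 2 * d" and r: "0 < r"
  shows "(\<integral>\<^sup>+z. ennreal (norm z powr - (2 * \<epsilon>)) * indicator (cball 0 r) z \<partial>(mu :: 'a measure))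
    = ennreal (weight_const d \<epsilon> * r powr (4 * d - 2 * \<epsilon>))"
proof -
  have "(\<lambda>z :: 'a. ennreal (norm z powr - (2 * \<epsilon>)) * indicator (cball 0 r) z) \<in> borel_measurable lebesgue"
    by (intro measurable_completion borel_measurable_times_ennreal borel_measurable_indicator) auto
  then have "(\<integral>\<^sup>+z. ennreal (norm z powr - (2 * \<epsilon>)) * indicator (cball 0 r) z \<partial>(mu :: 'a measure))
    = ennreal (1 / (2 * pi) powr (2 * d)) *
      ennreal (unit_ball_vol (4 * d) * (4 * d / (4 * d - 2 * \<epsilon>)) * r powr (4 * d - 2 * \<epsilon>))"
    using nn_integral_norm_powr_cball [where 'a = 'a, of "2 * \<epsilon>" r] \<epsilon> r
    by (simp add: nn_integral_mu d)
  also have "\<dots> = ennreal (1 / (2 * pi) powr (2 * d) * (unit_ball_vol (4 * d) * (4 * d / (4 * d - 2 * \<epsilon>))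
      * r powr (4 * d - 2 * \<epsilon>)))"
    using \<epsilon> by (intro ennreal_mult [symmetric]) auto
  also have "1 / (2 * pi) powr (2 * d) * (unit_ball_vol (4 * d) * (4 * d / (4 * d - 2 * \<epsilon>))
      * r powr (4 * d - 2 * \<epsilon>)) = weight_const d \<epsilon> * r powr (4 * d - 2 * \<epsilon>)"
  proof -
    have "Gamma (2 * d + 1) = 2 * d * Gamma (2 * d)"
      using \<epsilon> by (intro Gamma_plus1) (auto elim: nonpos_Ints_cases)
    moreover have "0 < Gamma (2 * d)" "0 < pi powr (2 * d)" "0 < (2::real) powr (2 * d)"
      using \<epsilon> by auto
    ultimately have "1 / (2 * pi) powr (2 * d) * (unit_ball_vol (4 * d) * (4 * d / (4 * d - 2 * \<epsilon>)))
        = weight_const d \<epsilon>"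
      using \<epsilon> by (simp add: weight_const_def unit_ball_vol_def powr_mult divide_simps)
    then show ?thesis
      by (metis mult.assoc)
  qed
  finally show ?thesis .
qed

section \<open>The concentration estimate for a bounded function\<close>

lemma ennreal_powr_powr: "ennreal_powr (ennreal_powr X a) b = ennreal_powr X (a * b)"
  by (cases X) (simp_all add: ennreal_powr_ennreal powr_powr)

lemma ennreal_powr_0 [simp]: "ennreal_powr 0 a = 0"
  by (simp add: ennreal_powr_def)

lemma ennreal_powr_mono: "X \<le> Y \<Longrightarrow> 0 \<le> a \<Longrightarrow> ennreal_powr X a \<le> ennreal_powr Y a"
  by (cases X; cases Y) (auto simp: ennreal_powr_ennreal top_unique intro: powr_mono2)

text \<open>Here \<open>h\<close> stands for the modulus of the transform, which enters only through
  its bound \<open>N\<close> and its weighted norm \<open>W\<close>. The power \<open>p + 1\<close>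
  on the left arises because the p-norm to the power \<open>p * (p + 1)\<close> is the integral to
  the power \<open>p + 1\<close>.\<close>

lemma weighted_concentration:
  fixes h :: "'a::euclidean_space \<Rightarrow> real" and d \<epsilon> p N S W :: real
  assumes d: "real DIM('a) = 4 * d" and \<epsilon>: "0 < \<epsilon>" "\<epsilon> < 2 * d" and p: "1 \<le> p"
    and h: "h \<in> borel_measurable lebesgue" "\<And>z. 0 \<le> h z" "\<And>z. h z \<le> N"
    and \<Sigma>: "\<Sigma> \<in> sets lebesgue" "emeasure mu \<Sigma> = ennreal S"
    and W: "(\<integral>\<^sup>+z. (ennreal (norm z powr \<epsilon> * h z))\<^sup>2 \<partial>mu) = (ennreal W)\<^sup>2"
    and pos: "0 < N" "0 < S" "0 < W"
  shows "ennreal_powr (\<integral>\<^sup>+z. ennreal (h z powr p) * indicator \<Sigma> z \<partial>mu) (p + 1)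
    \<le> ennreal (M_const d \<epsilon> p * S * W powr (4 * p * d / (2 * d + \<epsilon>))
        * N powr (p * (p - (2 * d - \<epsilon>) / (2 * d + \<epsilon>))))"
proof -
  \<comment> \<open>Since \<open>1 - \<theta> = 1 / (p + 1)\<close>, the measure of \<Sigma> appears
    to the first power after raising to \<open>p + 1\<close>. The condition
    \<open>2 * \<theta> \<le> p\<close> amounts to \<open>1 \<le> p\<close>.\<close>
  define \<theta> where "\<theta> = p / (p + 1)"
  have \<theta>: "0 < \<theta>" "\<theta> < 1" "1 * \<theta> \<le> p" "2 * \<theta> \<le> p" "1 - \<theta> = 1 / (p + 1)"
    using p by (simp_all add: \<theta>_def field_simps)
  define c where "c = weight_const d \<epsilon>"
  have c: "0 < c"
    using \<epsilon> by (simp add: c_def weight_const_pos)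
  \<comment> \<open>The p-th roots of the two Hoelder bounds for a ball of radius one.\<close>
  define A B where "A = S powr (1 / (p * (p + 1))) * N powr (p / (p + 1)) * W powr (1 / (p + 1))
      * c powr (1 / (2 * (p + 1)))"
    and "B = S powr (1 / (p * (p + 1))) * N powr ((p - 1) / (p + 1)) * W powr (2 / (p + 1))"
  have AB: "0 < A" "0 < B"
    using pos c by (simp_all add: A_def B_def)
  have \<alpha>\<beta>: "0 < 2 * d - \<epsilon>" "0 < 2 * \<epsilon>"
    using \<epsilon> by simp_all
  obtain \<rho> where \<rho>: "0 < \<rho>" and opt:
    "(A * \<rho> powr (2 * d - \<epsilon>) + B * \<rho> powr - (2 * \<epsilon>)) powr (p * (p + 1))
      = M_const d \<epsilon> p * S * W powr (4 * p * d / (2 * d + \<epsilon>))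
        * N powr (p * (p - (2 * d - \<epsilon>) / (2 * d + \<epsilon>)))"
    using powr_tradeoff_optimum [OF \<alpha>\<beta> AB] optimum_eq_M_const [OF \<epsilon> p pos(1,3,2)]
    unfolding A_def B_def c_def by metis
  \<comment> \<open>The exponent \<open>p + 1\<close> cancels \<open>\<theta> / p\<close>: a factor
    \<open>r powr a\<close> inside a Hoelder bound becomes \<open>\<rho> powr a\<close> after the
    p-th root.\<close>
  define r where "r = \<rho> powr (p + 1)"
  have r: "0 < r"
    using \<rho> by (simp add: r_def)
  have r_powr: "r powr a = \<rho> powr (a * (p + 1))" for a
    by (simp add: r_def powr_powr mult.commute)

  define E F where "E = \<Sigma> \<inter> cball 0 r" and "F = \<Sigma> - cball 0 r"
  have E: "E \<in> sets mu" and F: "F \<in> sets mu"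
    using \<Sigma>(1) by (simp_all add: E_def F_def sets.Int sets.Diff)
  have ES: "emeasure mu E \<le> ennreal S" and FS: "emeasure mu F \<le> ennreal S"
    unfolding \<Sigma>(2) [symmetric] using \<Sigma>(1)
    by (auto simp: E_def F_def intro!: emeasure_mono)
  have hmu: "h \<in> borel_measurable mu"
    using h(1) by simp
  have nmu: "(\<lambda>z :: 'a. norm z powr a) \<in> borel_measurable mu" for a
    unfolding borel_measurable_mu_iff by (rule measurable_completion) simp
  have Bmu: "cball (0 :: 'a) r \<in> sets mu"
    by simp

  have inside: "(\<integral>\<^sup>+z. ennreal (h z powr 1) * indicator E z \<partial>mu) \<le> ennreal (sqrt c * r powr (2 * d - \<epsilon>) * W)"
  proof -
    have "(\<integral>\<^sup>+z. ennreal (h z powr 1) * indicator E z \<partial>mu)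
      \<le> (\<integral>\<^sup>+z. (ennreal (norm z powr - \<epsilon>) * indicator (cball 0 r) z) * ennreal (norm z powr \<epsilon> * h z) \<partial>mu)"
    proof (rule nn_integral_mono_AE)
      \<comment> \<open>The weight and its reciprocal multiply to 1 except at the origin, where
        \<open>powr\<close> makes the product 0.\<close>
      have "AE z :: 'a in mu. z \<noteq> 0"
        by (simp add: AE_mu_iff AE_completion AE_lborel_singleton)
      then show "AE z in mu. ennreal (h z powr 1) * indicator E z
        \<le> (ennreal (norm z powr - \<epsilon>) * indicator (cball 0 r) z) * ennreal (norm z powr \<epsilon> * h z)"
      proof eventually_elim
        case (elim z)
        have "ennreal (norm z powr - \<epsilon>) * ennreal (norm z powr \<epsilon> * h z) = ennreal (h z)"
          using elim h(2) [of z] by (simp add: powr_minus flip: ennreal_mult)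
        then show ?case
          using h(2) [of z] by (auto simp: E_def split: split_indicator)
      qed
    qed
    then have "(\<integral>\<^sup>+z. ennreal (h z powr 1) * indicator E z \<partial>mu)\<^sup>2
      \<le> (\<integral>\<^sup>+z. (ennreal (norm z powr - \<epsilon>) * indicator (cball 0 r) z) * ennreal (norm z powr \<epsilon> * h z) \<partial>mu)\<^sup>2"
      by (simp only: ennreal_power2_le_iff)
    also have "\<dots> \<le> (\<integral>\<^sup>+z. (ennreal (norm z powr - \<epsilon>) * indicator (cball (0 :: 'a) r) z)\<^sup>2 \<partial>mu)
        * (\<integral>\<^sup>+z. (ennreal (norm z powr \<epsilon> * h z))\<^sup>2 \<partial>mu)"
    proof (rule Cauchy_Schwarz_nn_integral)
      show "(\<lambda>z. ennreal (norm z powr - \<epsilon>) * indicator (cball (0 :: 'a) r) z) \<in> borel_measurable mu"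
        using nmu Bmu by measurable
      show "(\<lambda>z. ennreal (norm z powr \<epsilon> * h z)) \<in> borel_measurable mu"
        using nmu hmu by measurable
    qed
    also have "(\<integral>\<^sup>+z. (ennreal (norm z powr - \<epsilon>) * indicator (cball (0 :: 'a) r) z)\<^sup>2 \<partial>mu)
      = (\<integral>\<^sup>+z. ennreal (norm z powr - (2 * \<epsilon>)) * indicator (cball (0 :: 'a) r) z \<partial>mu)"
      by (intro nn_integral_cong) (auto simp: power2_eq_square simp flip: powr_add ennreal_mult split: split_indicator)
    also have "\<dots> = ennreal (c * r powr (4 * d - 2 * \<epsilon>))"
      unfolding c_def by (rule nn_integral_mu_norm_powr_cball [OF d \<epsilon> r])
    also have "ennreal (c * r powr (4 * d - 2 * \<epsilon>)) = (ennreal (sqrt c * r powr (2 * d - \<epsilon>)))\<^sup>2"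
    proof -
      have "r powr (4 * d - 2 * \<epsilon>) = (r powr (2 * d - \<epsilon>))\<^sup>2"
        by (simp add: power2_eq_square flip: powr_add)
      then show ?thesis
        using c by (simp add: ennreal_power power_mult_distrib)
    qed
    also have "(ennreal (sqrt c * r powr (2 * d - \<epsilon>)))\<^sup>2 * (\<integral>\<^sup>+z. (ennreal (norm z powr \<epsilon> * h z))\<^sup>2 \<partial>mu)
        = (ennreal (sqrt c * r powr (2 * d - \<epsilon>) * W))\<^sup>2"
      unfolding W using c pos by (simp add: ennreal_mult power_mult_distrib)
    finally show ?thesis
      by (simp only: ennreal_power2_le_iff)
  qed
  have outside: "(\<integral>\<^sup>+z. ennreal (h z powr 2) * indicator F z \<partial>mu) \<le> ennreal (r powr - (2 * \<epsilon>) * W\<^sup>2)"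
  proof -
    have "(\<integral>\<^sup>+z. ennreal (h z powr 2) * indicator F z \<partial>mu)
      \<le> (\<integral>\<^sup>+z. ennreal (r powr - (2 * \<epsilon>)) * (ennreal (norm z powr \<epsilon> * h z))\<^sup>2 \<partial>mu)"
    proof (rule nn_integral_mono)
      fix z :: 'a
      show "ennreal (h z powr 2) * indicator F z
        \<le> ennreal (r powr - (2 * \<epsilon>)) * (ennreal (norm z powr \<epsilon> * h z))\<^sup>2"
      proof (cases "z \<in> F")
        case True
        then have z: "r \<le> norm z"
          by (simp add: F_def)
        \<comment> \<open>Outside the ball the weight divided by its value at radius
          \<open>r\<close> is at least one, so its square may be inserted as a factor.\<close>
        have "1 \<le> r powr - (2 * \<epsilon>) * norm z powr (2 * \<epsilon>)"
          using r z \<epsilon> powr_mono2 [of "2 * \<epsilon>" r "norm z"] by (simp add: powr_minus field_simps)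
        then have "1 * (h z)\<^sup>2 \<le> (r powr - (2 * \<epsilon>) * norm z powr (2 * \<epsilon>)) * (h z)\<^sup>2"
          by (intro mult_right_mono) simp_all
        moreover have "norm z powr (2 * \<epsilon>) = (norm z powr \<epsilon>)\<^sup>2"
          by (simp add: power2_eq_square flip: powr_add)
        ultimately have "h z powr 2 \<le> r powr - (2 * \<epsilon>) * (norm z powr \<epsilon> * h z)\<^sup>2"
          using h(2) [of z] by (simp add: power_mult_distrib mult_ac)
        then have "ennreal (h z powr 2) \<le> ennreal (r powr - (2 * \<epsilon>) * (norm z powr \<epsilon> * h z)\<^sup>2)"
          by (rule ennreal_leI)
        also have "\<dots> = ennreal (r powr - (2 * \<epsilon>)) * (ennreal (norm z powr \<epsilon> * h z))\<^sup>2"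
          using h(2) [of z] by (subst ennreal_power) (auto intro: ennreal_mult)
        finally show ?thesis
          using True by simp
      qed simp
    qed
    also have "\<dots> = ennreal (r powr - (2 * \<epsilon>)) * (ennreal W)\<^sup>2"
    proof -
      have "(\<lambda>z. (ennreal (norm z powr \<epsilon> * h z))\<^sup>2) \<in> borel_measurable mu"
        using nmu hmu by measurable
      then show ?thesis
        by (simp only: nn_integral_cmult W)
    qed
    also have "\<dots> = ennreal (r powr - (2 * \<epsilon>) * W\<^sup>2)"
      using pos by (simp add: ennreal_mult ennreal_power)
    finally show ?thesis .
  qed

  have "(\<integral>\<^sup>+z. ennreal (h z powr p) * indicator E z \<partial>mu)
      \<le> ennreal (N powr (p - 1 * \<theta>) * S powr (1 - \<theta>) * (sqrt c * r powr (2 * d - \<epsilon>) * W) powr \<theta>)"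
    using nn_integral_indicator_powr_le [OF hmu h(2,3) E ES \<theta>(1,2) _ \<theta>(3) pos(1,2) _ inside] c r pos
    by simp
  also have "N powr (p - 1 * \<theta>) * S powr (1 - \<theta>) * (sqrt c * r powr (2 * d - \<epsilon>) * W) powr \<theta>
      = (A * \<rho> powr (2 * d - \<epsilon>)) powr p"
  proof -
    \<comment> \<open>Both sides are positive products of powers once \<open>r\<close> is expressed
      by \<rho>; comparing logarithms leaves a rational identity in the exponents.\<close>
    have "ln (N powr (p - 1 * \<theta>) * S powr (1 - \<theta>) * (sqrt c * r powr (2 * d - \<epsilon>) * W) powr \<theta>)
        = ln ((A * \<rho> powr (2 * d - \<epsilon>)) powr p)"
      using pos c r \<rho> p unfolding A_def r_powr \<theta>_def
      by (simp add: ln_mult ln_sqrt) (simp add: divide_simps, algebra)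
    then show ?thesis
      using pos c r AB \<rho> by (subst (asm) ln_inj_iff) auto
  qed
  finally have 1: "(\<integral>\<^sup>+z. ennreal (h z powr p) * indicator E z \<partial>mu) \<le> ennreal ((A * \<rho> powr (2 * d - \<epsilon>)) powr p)" .
  have "(\<integral>\<^sup>+z. ennreal (h z powr p) * indicator F z \<partial>mu)
      \<le> ennreal (N powr (p - 2 * \<theta>) * S powr (1 - \<theta>) * (r powr - (2 * \<epsilon>) * W\<^sup>2) powr \<theta>)"
    using nn_integral_indicator_powr_le [OF hmu h(2,3) F FS \<theta>(1,2) _ \<theta>(4) pos(1,2) _ outside] r pos
    by simp
  also have "N powr (p - 2 * \<theta>) * S powr (1 - \<theta>) * (r powr - (2 * \<epsilon>) * W\<^sup>2) powr \<theta>
      = (B * \<rho> powr - (2 * \<epsilon>)) powr p"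
  proof -
    have "ln (N powr (p - 2 * \<theta>) * S powr (1 - \<theta>) * (r powr - (2 * \<epsilon>) * W\<^sup>2) powr \<theta>)
        = ln ((B * \<rho> powr - (2 * \<epsilon>)) powr p)"
      using pos c r \<rho> p unfolding B_def r_powr \<theta>_def
      by (simp add: ln_mult ln_realpow) (simp add: divide_simps, algebra)
    then show ?thesis
      using pos c r AB \<rho> by (subst (asm) ln_inj_iff) auto
  qed
  finally have 2: "(\<integral>\<^sup>+z. ennreal (h z powr p) * indicator F z \<partial>mu) \<le> ennreal ((B * \<rho> powr - (2 * \<epsilon>)) powr p)" .

  have "(\<integral>\<^sup>+z. ennreal (h z powr p) * indicator \<Sigma> z \<partial>mu)
    = (\<integral>\<^sup>+z. ennreal (h z powr p) * indicator E z + ennreal (h z powr p) * indicator F z \<partial>mu)"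
    by (intro nn_integral_cong) (auto simp: E_def F_def split: split_indicator)
  also have "\<dots> = (\<integral>\<^sup>+z. ennreal (h z powr p) * indicator E z \<partial>mu) + (\<integral>\<^sup>+z. ennreal (h z powr p) * indicator F z \<partial>mu)"
  proof (rule nn_integral_add)
    show "(\<lambda>z. ennreal (h z powr p) * indicator E z) \<in> borel_measurable mu"
      using hmu E by measurable
    show "(\<lambda>z. ennreal (h z powr p) * indicator F z) \<in> borel_measurable mu"
      using hmu F by measurable
  qed
  also have "\<dots> \<le> ennreal ((A * \<rho> powr (2 * d - \<epsilon>)) powr p) + ennreal ((B * \<rho> powr - (2 * \<epsilon>)) powr p)"
    by (rule add_mono [OF 1 2])
  also have "\<dots> = ennreal ((A * \<rho> powr (2 * d - \<epsilon>)) powr p + (B * \<rho> powr - (2 * \<epsilon>)) powr p)"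
    by simp
  \<comment> \<open>Superadditivity of the p-th power merges the two bounds into a power of the one
    sum whose value at \<rho> is known from \<open>opt\<close>.\<close>
  also have "\<dots> \<le> ennreal ((A * \<rho> powr (2 * d - \<epsilon>) + B * \<rho> powr - (2 * \<epsilon>)) powr p)"
    using AB p by (intro ennreal_leI add_powr_le_powr_add) auto
  finally have "ennreal_powr (\<integral>\<^sup>+z. ennreal (h z powr p) * indicator \<Sigma> z \<partial>mu) (p + 1)
      \<le> ennreal_powr (ennreal ((A * \<rho> powr (2 * d - \<epsilon>) + B * \<rho> powr - (2 * \<epsilon>)) powr p)) (p + 1)"
    using p by (intro ennreal_powr_mono) auto
  also have "\<dots> = ennreal ((A * \<rho> powr (2 * d - \<epsilon>) + B * \<rho> powr - (2 * \<epsilon>)) powr (p * (p + 1)))"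
    by (simp add: ennreal_powr_ennreal powr_powr)
  finally show ?thesis
    unfolding opt .
qed

section \<open>Application to the transform, including the degenerate and infinite cases\<close>

theorem theorem12:
  fixes d \<epsilon> p :: real
  assumes "d = real CARD('d::finite)"
    and "0 < \<epsilon>" and "\<epsilon> < 2 * d" and "1 \<le> p"
  shows "\<exists>M\<ge>0. M = M_const d \<epsilon> p \<and>
    (\<forall>(g :: 'd R2d \<Rightarrow> quat) (f :: 'd R2d \<Rightarrow> quat) (\<Sigma> :: 'd R4d set).
       quat_window g \<longrightarrow> f \<in> L2 \<longrightarrow> \<Sigma> \<in> sets lebesgue \<longrightarrow> emeasure mu \<Sigma> < \<infinity> \<longrightarrow>
       ennreal_powr (Lp_norm p (\<lambda>z. indicator \<Sigma> z *\<^sub>R qwft g f z)) (p * (p + 1))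
       \<le> ennreal M * emeasure mu \<Sigma>
          * ennreal_powr (Lp_norm 2 (\<lambda>z. (norm z powr \<epsilon>) *\<^sub>R qwft g f z)) (4 * p * d / (2 * d + \<epsilon>))
          * ennreal_powr (Lp_norm 2 f * Lp_norm 2 g) (p * (p - (2 * d - \<epsilon>) / (2 * d + \<epsilon>))))"
proof (intro exI conjI allI impI)
  have M: "0 < M_const d \<epsilon> p"
    by (rule M_const_pos [OF assms(2,3)])
  then show "0 \<le> M_const d \<epsilon> p"
    by simp
  show "M_const d \<epsilon> p = M_const d \<epsilon> p" ..
  fix g f :: "'d R2d \<Rightarrow> quat" and \<Sigma> :: "'d R4d set"
  assume g: "quat_window g" and f: "f \<in> L2" and \<Sigma>: "\<Sigma> \<in> sets lebesgue" "emeasure mu \<Sigma> < \<infinity>"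
  define h where "h = (\<lambda>z. norm (qwft g f z))"
  define I where "I = (\<integral>\<^sup>+z. ennreal (h z powr p) * indicator \<Sigma> z \<partial>mu)"
  define X where "X = Lp_norm 2 (\<lambda>z. (norm z powr \<epsilon>) *\<^sub>R qwft g f z)"
  have fg: "f \<in> borel_measurable lebesgue" "g \<in> borel_measurable lebesgue"
    and "Lp_norm 2 f < \<infinity>" "Lp_norm 2 g < \<infinity>"
    using f g by (simp_all add: L2_def quat_window_def)
  then have "Lp_norm 2 f * Lp_norm 2 g < \<infinity>"
    by (simp add: ennreal_mult_less_top)
  then obtain N where N: "Lp_norm 2 f * Lp_norm 2 g = ennreal N" "0 \<le> N"
    by (cases "Lp_norm 2 f * Lp_norm 2 g") auto
  obtain S where S: "emeasure mu \<Sigma> = ennreal S" "0 \<le> S"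
    using \<Sigma>(2) by (cases "emeasure mu \<Sigma>") auto
  have "qwft g f \<in> borel_measurable lborel"
    using borel_measurable_qwft [OF fg] by simp
  then have "qwft g f \<in> borel_measurable lebesgue"
    by (rule measurable_completion)
  then have h: "h \<in> borel_measurable lebesgue"
    unfolding h_def by (rule measurable_compose [OF _ borel_measurable_norm])
  have h0: "0 \<le> h z" for z
    by (simp add: h_def)
  have hN: "h z \<le> N" for z
    using norm_qwft_le [OF fg, of z] N by (simp add: h_def)
  have X2: "X\<^sup>2 = (\<integral>\<^sup>+z. (ennreal (norm z powr \<epsilon> * h z))\<^sup>2 \<partial>mu)"
    by (simp add: X_def h_def Lp_norm_2_power2)
  have exps: "0 < 2 * d + \<epsilon>" "p - (2 * d - \<epsilon>) / (2 * d + \<epsilon>) > 0"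
  proof -
    show "0 < 2 * d + \<epsilon>" using assms by simp
    moreover have "(2 * d - \<epsilon>) / (2 * d + \<epsilon>) < 1"
      using assms by simp
    ultimately show "p - (2 * d - \<epsilon>) / (2 * d + \<epsilon>) > 0"
      using assms(4) by linarith
  qed
  have "Lp_norm p (\<lambda>z. indicator \<Sigma> z *\<^sub>R qwft g f z) = ennreal_powr I (1 / p)"
    unfolding Lp_norm_def I_def h_def using assms(4)
    by (intro arg_cong2 [where f = ennreal_powr] nn_integral_cong) (auto split: split_indicator)
  then have lhs: "ennreal_powr (Lp_norm p (\<lambda>z. indicator \<Sigma> z *\<^sub>R qwft g f z)) (p * (p + 1))
      = ennreal_powr I (p + 1)"
    using assms(4) by (simp add: ennreal_powr_powr)
  have "ennreal_powr I (p + 1) \<le> ennreal (M_const d \<epsilon> p) * ennreal S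
      * ennreal_powr X (4 * p * d / (2 * d + \<epsilon>))
      * ennreal_powr (ennreal N) (p * (p - (2 * d - \<epsilon>) / (2 * d + \<epsilon>)))"
  \<comment> \<open>The estimate is for positive finite parameters. If any of the three vanishes,
    the integrand is zero almost everywhere and so is the left side, whatever the other factors on
    the right are.\<close>
  proof (cases "S = 0 \<or> N = 0 \<or> X = 0")
    case True
    have "AE z in mu. ennreal (h z powr p) * indicator \<Sigma> z = 0"
    proof -
      consider "S = 0" | "N = 0" | "X = 0"
        using True by auto
      then show ?thesis
      proof cases
        case 1
        then have "\<Sigma> \<in> null_sets mu"
          using S \<Sigma>(1) by (simp add: null_sets_def)
        then have "AE z in mu. z \<notin> \<Sigma>"
          by (rule AE_not_in)
        then show ?thesis
          by eventually_elim simp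
      next
        case 2
        then have "h z = 0" for z
          using h0 [of z] hN [of z] by simp
        then show ?thesis by simp
      next
        case 3
        have "(\<lambda>z :: 'd R4d. norm z powr \<epsilon>) \<in> borel_measurable lebesgue"
          by (rule measurable_completion) simp
        then have "(\<lambda>z. (ennreal (norm z powr \<epsilon> * h z))\<^sup>2) \<in> borel_measurable mu"
          unfolding borel_measurable_mu_iff using h by measurable
        \<comment> \<open>A vanishing weighted norm kills the product of weight and \<open>h\<close>
          almost everywhere; off the origin the weight is positive, so \<open>h\<close> itself
          vanishes.\<close>
        then have "AE z in mu. (ennreal (norm z powr \<epsilon> * h z))\<^sup>2 = 0"
          using 3 X2 by (simp add: nn_integral_0_iff_AE)
        moreover have "AE z :: 'd R4d in mu. z \<noteq> 0"
          by (simp add: AE_mu_iff AE_completion AE_lborel_singleton)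
        ultimately show ?thesis
        proof eventually_elim
          case (elim z)
          then have "norm z powr \<epsilon> * h z \<le> 0" and "0 < norm z powr \<epsilon>"
            by (simp_all add: ennreal_eq_0_iff)
          then have "h z = 0"
            using h0 [of z] by (simp add: mult_le_0_iff)
          then show ?case by simp
        qed
      qed
    qed
    then have "I = (\<integral>\<^sup>+z. 0 \<partial>(mu :: 'd R4d measure))"
      unfolding I_def by (rule nn_integral_cong_AE)
    then show ?thesis by simp
  next
    case False
    then have pos: "0 < S" "0 < N" "0 < X"
      using S N by (auto simp: zero_less_iff_neq_zero)
    show ?thesis
    proof (cases X)
      case (real W)
      then have "0 < W"
        using pos by simp
      have "real DIM('d R4d) = 4 * d"
        using assms(1) by simp
      from weighted_concentration [OF this assms(2-4) h h0 hN \<Sigma>(1) S(1) _ pos(2,1) \<open>0 < W\<close>]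
      have "ennreal_powr I (p + 1) \<le> ennreal (M_const d \<epsilon> p * S * W powr (4 * p * d / (2 * d + \<epsilon>))
        * N powr (p * (p - (2 * d - \<epsilon>) / (2 * d + \<epsilon>))))"
        using X2 real by (simp add: I_def)
      then show ?thesis
        using M S(2) N(2) real by (simp add: ennreal_powr_ennreal ennreal_mult)
    next
      \<comment> \<open>The remaining factors on the right are positive, so the right side is
        infinite.\<close>
      case top
      then show ?thesis
        using M pos by (simp add: ennreal_powr_ennreal ennreal_top_mult ennreal_mult_top)
    qed
  qed
  then show "ennreal_powr (Lp_norm p (\<lambda>z. indicator \<Sigma> z *\<^sub>R qwft g f z)) (p * (p + 1))
      \<le> ennreal (M_const d \<epsilon> p) * emeasure mu \<Sigma>
        * ennreal_powr (Lp_norm 2 (\<lambda>z. (norm z powr \<epsilon>) *\<^sub>R qwft g f z)) (4 * p * d / (2 * d + \<epsilon>))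
        * ennreal_powr (Lp_norm 2 f * Lp_norm 2 g) (p * (p - (2 * d - \<epsilon>) / (2 * d + \<epsilon>)))"
    by (simp only: lhs S(1) N(1) X_def)
qed

end
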